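(* There exists a transitive almost diam-mean equicontinuous topological dynamical system with positive topological entropy.
   Context: A topological dynamical system (t.d.s.) $(X,T)$ is a compact metric space $X$ with a continuous map $T:X\to X$. It is transitive if for any non-empty open sets $U,V\subset X$ there is $n\in\mathbb{N}$ with $T^nU\cap V\ne\emptyset$. $B_\delta(x)$ is the open ball of radius $\delta$ about $x$. A point $x\in X$ is a diam-mean equicontinuity point if for every $\varepsilon>0$ there is $\delta>0$ with $\limsup_{N\to\infty}\frac1N\sum_{i=1}^N\operatorname{diam}(T^iB_\delta(x))<\varepsilon$. $(X,T)$ is almost diam-mean equicontinuous if the set of its diam-mean equicontinuity points is residual in $X$. *)

theory Defs
  imports "HOL-Analysis.Analysis"
begin

section \<open>Residual sets\<close>

definition residual_in :: "'a topology \<Rightarrow> 'a set \<Rightarrow> bool" where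
  "residual_in X S \<longleftrightarrow> S \<subseteq> topspace X \<and>
     (\<exists>\<G>. countable \<G> \<and> (\<forall>G\<in>\<G>. openin X G \<and> X closure_of G = topspace X) \<and>
          topspace X \<inter> \<Inter>\<G> \<subseteq> S)"

section \<open>Topological entropy (Adler, Konheim, McAndrew)\<close>

definition open_cover :: "'a topology \<Rightarrow> 'a set set \<Rightarrow> bool" where
  "open_cover X \<U> \<longleftrightarrow> (\<forall>U\<in>\<U>. openin X U) \<and> \<Union>\<U> = topspace X"

text \<open>If the space is compact and the cover is open, the set of cardinalities below is
  nonempty, so that the infimum is a minimum.\<close>

definition min_subcover_card :: "'a topology \<Rightarrow> 'a set set \<Rightarrow> nat" where
  "min_subcover_card X \<U> =
     Inf {card \<V> |\<V>. \<V> \<subseteq> \<U> \<and> finite \<V> \<and> \<Union>\<V> = topspace X}"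

text \<open>The common refinement of the covers \<open>\<U>\<close>, \<open>T\<^sup>-\<^sup>1 \<U>\<close>, \dots, \<open>T\<^sup>-\<^sup>(\<^sup>n\<^sup>-\<^sup>1\<^sup>) \<U>\<close>; the map \<open>T\<close> is only
  relevant on \<open>topspace X\<close>, so preimages are taken there.\<close>

definition cover_refinement ::
  "'a topology \<Rightarrow> ('a \<Rightarrow> 'a) \<Rightarrow> 'a set set \<Rightarrow> nat \<Rightarrow> 'a set set" where
  "cover_refinement X T \<U> n =
     {{x \<in> topspace X. \<forall>i<n. (T ^^ i) x \<in> W i} |W. \<forall>i<n. W i \<in> \<U>}"

text \<open>For a continuous self-map of a compact space the sequence
  \<open>ln (min_subcover_card X (cover_refinement X T \<U> n))\<close> is subadditive in \<open>n\<close>, so the upper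
  limit is the limit of the usual definition.\<close>

definition cover_entropy :: "'a topology \<Rightarrow> ('a \<Rightarrow> 'a) \<Rightarrow> 'a set set \<Rightarrow> ereal" where
  "cover_entropy X T \<U> =
     limsup (\<lambda>n. ereal (ln (real (min_subcover_card X (cover_refinement X T \<U> n))) / real n))"

definition topological_entropy :: "'a topology \<Rightarrow> ('a \<Rightarrow> 'a) \<Rightarrow> ereal" where
  "topological_entropy X T = (SUP \<U>\<in>{\<U>. open_cover X \<U>}. cover_entropy X T \<U>)"

section \<open>Topological dynamical systems\<close>

text \<open>The library's \<open>diameter\<close> is only available for type-class metrics; this is its analogue for
  a metric on a carrier set.\<close>

definition (in Metric_space) mdiameter :: "'a set \<Rightarrow> real" where
  "mdiameter S = (if S = {} then 0 else SUP (x, y)\<in>S \<times> S. d x y)"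

locale topological_dynamical_system = Metric_space M d
  for M :: "'a set" and d :: "'a \<Rightarrow> 'a \<Rightarrow> real" +
  fixes T :: "'a \<Rightarrow> 'a"
  assumes compact: "compact_space mtopology"
    and continuous: "continuous_map mtopology mtopology T"
begin

text \<open>Times are positive integers here. Allowing \<open>n = 0\<close> gives an equivalent notion.\<close>

definition transitive :: bool where
  "transitive \<longleftrightarrow>
     (\<forall>U V. openin mtopology U \<and> U \<noteq> {} \<and> openin mtopology V \<and> V \<noteq> {} \<longrightarrow>
        (\<exists>n\<ge>1. (T ^^ n) ` U \<inter> V \<noteq> {}))"

definition diam_mean_equicontinuity_point :: "'a \<Rightarrow> bool" where
  "diam_mean_equicontinuity_point x \<longleftrightarrow> x \<in> M \<and>
     (\<forall>\<epsilon>>0. \<exists>\<delta>>0.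
        limsup (\<lambda>N. ereal ((\<Sum>i=1..N. mdiameter ((T ^^ i) ` mball x \<delta>)) / real N)) < ereal \<epsilon>)"

definition almost_diam_mean_equicontinuous :: bool where
  "almost_diam_mean_equicontinuous \<longleftrightarrow>
     residual_in mtopology {x. diam_mean_equicontinuity_point x}"

end

end

theory Submission
  imports Defs "HOL-Real_Asymp.Real_Asymp"
begin

text \<open>The system is the one-sided subshift of all sequences over \<open>{0, 1, 2}\<close> in which a symbol \<open>2\<close>
  forces all later symbols to be \<open>0\<close>, except at distances from the set \<open>gaps\<close> of density zero. Every
  sequence containing a \<open>2\<close> is then a diam-mean equicontinuity point, because at most times its
  near neighbours are all close to the zero sequence. As \<open>gaps\<close> contains arbitrarily long intervals,
  any two words can be joined by a suitable number of zeros, so the subshift is transitive, and the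
  sequences containing a \<open>2\<close> are dense. Sequences without a \<open>2\<close> are unconstrained, so the full shift over \<open>{0, 1}\<close>
  is contained in the system and provides the entropy.\<close>

section \<open>A density zero set with long intervals\<close>

text \<open>The block at \<open>2 ^ n\<close> has \<open>2 * n + 1\<close> elements: with
  \<open>a = 2 ^ n + n\<close> it consists of all \<open>a + j - i\<close> with
  \<open>i, j \<le> n\<close>, the distances between positions of two words of length
  \<open>n + 1\<close> placed \<open>a\<close> apart.\<close>

definition gaps :: "nat set" where
  "gaps = (\<Union>n. {2 ^ n..2 ^ n + 2 * n})"

text \<open>Only blocks with \<open>n \<le> k\<close>, the integer part of \<open>log 2 N\<close>,
  meet \<open>{..N}\<close>, and their sizes are the first \<open>k + 1\<close> odd numbers, with
  sum \<open>(k + 1) ^ 2\<close>.\<close>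

lemma card_gaps_le:
  assumes "N \<ge> 1"
  shows "real (card (gaps \<inter> {..N})) \<le> (log 2 (real N) + 1) ^ 2"
proof -
  define k where "k = nat \<lfloor>log 2 (real N)\<rfloor>"
  have le: "n \<le> k" if "2 ^ n \<le> N" for n
  proof -
    have "real (2 ^ n) \<le> real N" using that by (rule of_nat_mono)
    then have "real n \<le> log 2 (real N)"
      using assms by (simp add: le_log_iff powr_realpow)
    then show ?thesis unfolding k_def by linarith
  qed
  have "gaps \<inter> {..N} \<subseteq> (\<Union>n\<le>k. {2 ^ n..2 ^ n + 2 * n})"
    unfolding gaps_def using le by fastforce
  then have "card (gaps \<inter> {..N}) \<le> card (\<Union>n\<le>k. {2 ^ n..2 ^ n + 2 * n})"
    by (intro card_mono) auto
  also have "\<dots> \<le> (\<Sum>n\<le>k. card {2 ^ n..2 ^ n + 2 * n})"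
    by (intro card_UN_le) auto
  also have "\<dots> = (k + 1) ^ 2"
    by (induction k) (auto simp: power2_eq_square)
  finally have "real (card (gaps \<inter> {..N})) \<le> (real k + 1) ^ 2"
    by (metis of_nat_1 of_nat_add of_nat_le_iff of_nat_power)
  also have "\<dots> \<le> (log 2 (real N) + 1) ^ 2"
    using assms unfolding k_def by (intro power_mono) auto
  finally show ?thesis .
qed

text \<open>The offset \<open>r\<close> allows for looking at the first \<open>r + 1\<close>
  coordinates at every time up to \<open>N\<close>.\<close>

lemma gaps_density_zero: "(\<lambda>N. real (card (gaps \<inter> {..N + r})) / real N) \<longlonglongrightarrow> 0"
proof (rule real_tendsto_sandwich)
  show "\<forall>\<^sub>F N in sequentially. 0 \<le> real (card (gaps \<inter> {..N + r})) / real N"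
    by simp
  show "\<forall>\<^sub>F N in sequentially. real (card (gaps \<inter> {..N + r})) / real N
          \<le> (log 2 (real N + real r) + 1) ^ 2 / real N"
    using eventually_ge_at_top[of 1]
  proof eventually_elim
    case (elim N)
    then show ?case
      using card_gaps_le[of "N + r"] by (simp add: divide_right_mono)
  qed
  show "(\<lambda>N. (log 2 (real N + real r) + 1) ^ 2 / real N) \<longlonglongrightarrow> 0"
    by real_asymp
qed simp

section \<open>The subshift\<close>

text \<open>The metric of \<open>HOL-Analysis.Function_Metric\<close> enumerates the index set by an unspecified
  function \<open>from_nat\<close>, so there is no explicit bound for \<open>K\<close>.\<close>

lemma dist_fun_less_if_agree:
  fixes e :: real
  assumes "e > 0"
  obtains K where "\<And>x y :: nat \<Rightarrow> 'b :: metric_space. (\<And>j. j \<le> K \<Longrightarrow> x j = y j) \<Longrightarrow> dist x y < e"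
proof -
  obtain r where r: "(1 / 2 :: real) ^ r < e"
    using real_arch_pow_inv[OF assms, of "1/2"] by auto
  define K where "K = Max (from_nat ` {..r} :: nat set)"
  have "dist x y < e" if "\<And>j. j \<le> K \<Longrightarrow> x j = y j" for x y :: "nat \<Rightarrow> 'b"
  proof -
    have "x (from_nat n) = y (from_nat n)" if "n \<le> r" for n
      using that by (intro \<open>\<And>j. j \<le> K \<Longrightarrow> x j = y j\<close>) (auto simp: K_def)
    then have "{dist (x (from_nat n)) (y (from_nat n)) |n. n \<le> r} = {0}"
      by force
    then show ?thesis
      using dist_fun_le_dist_first_terms[of x y r] r by simp
  qed
  then show ?thesis using that by blast
qed

text \<open>Each coordinate distance is truncated at 1, so the geometric series of the weights
  bounds the metric. This crude bound serves at the exceptional times.\<close>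

lemma dist_fun_le_2:
  fixes x y :: "nat \<Rightarrow> 'b :: metric_space"
  shows "dist x y \<le> 2"
proof -
  have "summable (\<lambda>n. (1/2) ^ n * min (dist (x (from_nat n)) (y (from_nat n))) 1)"
    by (rule summable_comparison_test'[of "\<lambda>n. (1/2) ^ n" 0]) auto
  then have "dist x y \<le> (\<Sum>n. (1/2) ^ n)"
    unfolding dist_fun_def by (intro suminf_le) auto
  then show ?thesis
    by (simp add: suminf_geometric)
qed

section \<open>The shift map and the compact invariant set\<close>

definition shift :: "(nat \<Rightarrow> 'a) \<Rightarrow> nat \<Rightarrow> 'a" where
  "shift x = (\<lambda>i. x (Suc i))"

lemma shift_funpow: "(shift ^^ n) x = (\<lambda>i. x (i + n))"
  by (induction n arbitrary: x) (auto simp: shift_def)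

text \<open>The alphabet lies in \<open>real\<close>, so that \<open>dist\<close> on
  \<open>nat \<Rightarrow> real\<close> is available as the metric. Only differences of positions
  are constrained, which makes the set invariant under \<open>shift\<close>.\<close>

definition gap_shift :: "(nat \<Rightarrow> real) set" where
  "gap_shift = {x. range x \<subseteq> {0, 1, 2} \<and> (\<forall>p q. p < q \<and> x p = 2 \<and> x q \<noteq> 0 \<longrightarrow> q - p \<in> gaps)}"

lemma compact_gap_shift: "compact gap_shift"
proof -
  have "compactin (product_topology (\<lambda>_::nat. euclidean :: real topology) UNIV) (PiE UNIV (\<lambda>_. {0, 1, 2}))"
    by (simp add: compactin_PiE)
  then have compact: "compact (PiE UNIV (\<lambda>_::nat. {0, 1, 2 :: real}))"
    by (simp add: euclidean_product_topology)
  \<comment> \<open>Over the alphabet, \<open>x p \<noteq> 2\<close> means that \<open>x p\<close>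
    is 0 or 1; stated this way the condition is closed among all real sequences.\<close>
  have "closed {x :: nat \<Rightarrow> real. x p = 0 \<or> x p = 1 \<or> x q = 0}" for p q
    by (intro closed_Collect_disj closed_Collect_eq continuous_intros continuous_on_product_coordinates)
  then have closed: "closed (\<Inter>(p, q)\<in>{(p, q). p < q \<and> q - p \<notin> gaps}.
      {x :: nat \<Rightarrow> real. x p = 0 \<or> x p = 1 \<or> x q = 0})"
    by (intro closed_INT) auto
  have "gap_shift = PiE UNIV (\<lambda>_::nat. {0, 1, 2 :: real}) \<inter>
      (\<Inter>(p, q)\<in>{(p, q). p < q \<and> q - p \<notin> gaps}. {x :: nat \<Rightarrow> real. x p = 0 \<or> x p = 1 \<or> x q = 0})"
    (is "_ = ?A \<inter> ?B")
  proof (intro subset_antisym subsetI)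
    fix x assume "x \<in> gap_shift"
    then show "x \<in> ?A \<inter> ?B"
      by (fastforce simp: gap_shift_def PiE_def Pi_def image_subset_iff)
  next
    fix x assume x: "x \<in> ?A \<inter> ?B"
    then have "q - p \<in> gaps" if "p < q" "x p = 2" "x q \<noteq> 0" for p q
      using that by force
    then show "x \<in> gap_shift"
      using x by (auto simp: gap_shift_def PiE_def Pi_def)
  qed
  then show ?thesis
    by (rule ssubst) (rule compact_Int_closed[OF compact closed])
qed

lemma continuous_on_shift: "continuous_on S (shift :: (nat \<Rightarrow> 'a :: topological_space) \<Rightarrow> _)"
  unfolding shift_def
  by (intro continuous_on_coordinatewise_then_product continuous_on_subset[OF continuous_on_product_coordinates]) auto

lemma shift_mem_gap_shift: "x \<in> gap_shift \<Longrightarrow> shift x \<in> gap_shift"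
  unfolding gap_shift_def shift_def by (auto simp: image_subset_iff) (metis Suc_less_eq diff_Suc_Suc)

lemma funpow_shift_mem_gap_shift: "x \<in> gap_shift \<Longrightarrow> (shift ^^ n) x \<in> gap_shift"
  by (induction n) (auto simp: shift_mem_gap_shift)

lemma mtopology_gap_shift: "Metric_space.mtopology gap_shift dist = top_of_set gap_shift"
proof -
  have "Submetric UNIV dist gap_shift"
    by unfold_locales auto
  from Submetric.mtopology_submetric[OF this] show ?thesis by simp
qed

interpretation gap: topological_dynamical_system gap_shift dist shift
proof (intro topological_dynamical_system.intro topological_dynamical_system_axioms.intro)
  show "Metric_space gap_shift dist"
    by (simp add: Met_TC.subspace)
  show "compact_space (Metric_space.mtopology gap_shift dist)"
    unfolding mtopology_gap_shift using compact_gap_shift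
    by (simp add: compact_space_subtopology)
  show "continuous_map (Metric_space.mtopology gap_shift dist) (Metric_space.mtopology gap_shift dist) shift"
    unfolding mtopology_gap_shift
    by (auto simp: continuous_map_in_subtopology continuous_on_shift shift_mem_gap_shift)
qed

section \<open>Joining words, transitivity and cylinders\<close>

text \<open>The initial word of \<open>x\<close>, then zeros, then that of \<open>y\<close> starting
  at \<open>a\<close>, then zeros again. Distances between the two words lie in
  \<open>{a - n..a + n}\<close>, which is the block of \<open>gaps\<close> at
  \<open>2 ^ n\<close>.\<close>

lemma join_words:
  assumes "x \<in> gap_shift" "y \<in> gap_shift"
  obtains w a where "w \<in> gap_shift" "a \<ge> 1" "\<And>i. i \<le> n \<Longrightarrow> w i = x i" "\<And>i. i \<le> n \<Longrightarrow> w (i + a) = y i"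
proof -
  define a :: nat where "a = 2 ^ n + n"
  define w where "w = (\<lambda>i. if i \<le> n then x i else if a \<le> i \<and> i \<le> a + n then y (i - a) else 0)"
  have "n < a" by (simp add: a_def)
  have "q - p \<in> gaps" if pq: "p < q" "w p = 2" "w q \<noteq> 0" for p q
  proof -
    \<comment> \<open>Both \<open>w p\<close> and \<open>w q\<close> are nonzero, so each position
      lies in one of the two words.\<close>
    consider "q \<le> n" | "p \<le> n" "a \<le> q" "q \<le> a + n" | "a \<le> p" "q \<le> a + n"
      using pq \<open>n < a\<close> unfolding w_def by (force split: if_splits)
    then show ?thesis
    proof cases
      case 1
      then show ?thesis using pq assms(1) by (auto simp: w_def gap_shift_def)
    next
      case 2
      then have "q - p \<in> {2 ^ n..2 ^ n + 2 * n}" by (auto simp: a_def)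
      then show ?thesis unfolding gaps_def by blast
    next
      case 3
      have "(q - a) - (p - a) \<in> gaps"
      proof -
        have "p - a < q - a" "y (p - a) = 2" "y (q - a) \<noteq> 0"
          using 3 pq \<open>n < a\<close> by (auto simp: w_def split: if_splits)
        then show ?thesis using assms(2) unfolding gap_shift_def by blast
      qed
      moreover have "(q - a) - (p - a) = q - p" using 3 by simp
      ultimately show ?thesis by simp
    qed
  qed
  moreover have "range w \<subseteq> {0, 1, 2}"
    using assms by (auto simp: w_def gap_shift_def image_subset_iff)
  ultimately have "w \<in> gap_shift" by (auto simp: gap_shift_def)
  then show ?thesis
    using that[of w a] \<open>n < a\<close> by (auto simp: w_def)
qed

text \<open>Agreement on a long prefix forces a small distance, so questions about open sets reduce
  to finite words.\<close>

lemma open_gap_shift_cylinder: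
  assumes "openin gap.mtopology U" "x \<in> U"
  obtains n where "x \<in> gap_shift" "\<And>y. y \<in> gap_shift \<Longrightarrow> (\<And>i. i \<le> n \<Longrightarrow> y i = x i) \<Longrightarrow> y \<in> U"
proof -
  obtain e where e: "e > 0" "gap.mball x e \<subseteq> U"
    using assms by (auto simp: gap.openin_mtopology)
  obtain n where n: "\<And>x y :: nat \<Rightarrow> real. (\<And>i. i \<le> n \<Longrightarrow> x i = y i) \<Longrightarrow> dist x y < e"
    using dist_fun_less_if_agree[OF e(1)] by blast
  have x: "x \<in> gap_shift"
    using openin_subset[OF assms(1)] assms(2) by auto
  moreover have "y \<in> U" if "y \<in> gap_shift" "\<And>i. i \<le> n \<Longrightarrow> y i = x i" for y
    using n[of x y] that e x by (auto simp: subset_iff)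
  ultimately show ?thesis using that by blast
qed

lemma transitive_gap_shift: "gap.transitive"
  unfolding gap.transitive_def
proof (intro allI impI, elim conjE)
  fix U V
  assume U: "openin gap.mtopology U" and V: "openin gap.mtopology V" and "U \<noteq> {}" "V \<noteq> {}"
  then obtain x y where "x \<in> U" "y \<in> V" by blast
  obtain m where m: "x \<in> gap_shift" "\<And>z. z \<in> gap_shift \<Longrightarrow> (\<And>i. i \<le> m \<Longrightarrow> z i = x i) \<Longrightarrow> z \<in> U"
    using open_gap_shift_cylinder[OF U \<open>x \<in> U\<close>] by blast
  obtain n where n: "y \<in> gap_shift" "\<And>z. z \<in> gap_shift \<Longrightarrow> (\<And>i. i \<le> n \<Longrightarrow> z i = y i) \<Longrightarrow> z \<in> V"
    using open_gap_shift_cylinder[OF V \<open>y \<in> V\<close>] by blast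
  obtain w a where w: "w \<in> gap_shift" "a \<ge> 1" "\<And>i. i \<le> max m n \<Longrightarrow> w i = x i"
      "\<And>i. i \<le> max m n \<Longrightarrow> w (i + a) = y i"
    using join_words[OF m(1) n(1), of "max m n"] by blast
  have "w \<in> U" using w m by simp
  moreover have "(shift ^^ a) w \<in> V"
    using w n(2)[OF funpow_shift_mem_gap_shift[OF w(1), of a]] by (simp add: shift_funpow)
  ultimately show "\<exists>n\<ge>1. (shift ^^ n) ` U \<inter> V \<noteq> {}"
    using w(2) by blast
qed

text \<open>The alphabet is discrete: fixing a symbol amounts to avoiding the finitely many others,
  which is an open condition. For \<open>s\<close> outside the alphabet the set is empty.\<close>

lemma open_cylinder_gap_shift: "openin gap.mtopology {x \<in> gap_shift. x n = s}"
proof -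
  have "{x \<in> gap_shift. x n = s} = gap_shift \<inter> {x. x n \<in> - ({0, 1, 2} - {s})}"
    if "s \<in> {0, 1, 2}"
    using that by (auto simp: gap_shift_def image_subset_iff)
  moreover have "open {x :: nat \<Rightarrow> real. x n \<in> - ({0, 1, 2} - {s})}"
    using open_vimage[OF _ continuous_on_product_coordinates, of "- ({0, 1, 2} - {s})" n]
    unfolding vimage_def by (simp only: open_Compl finite_imp_closed finite_Diff finite.intros)
  moreover have "{x \<in> gap_shift. x n = s} = {}" if "s \<notin> {0, 1, 2}"
    using that by (auto simp: gap_shift_def image_subset_iff)
  ultimately show ?thesis
    unfolding mtopology_gap_shift
    by (cases "s \<in> {0, 1, 2}") (simp_all only: openin_empty openin_open_Int not_False_eq_True True_implies_equals)
qed

section \<open>Diam-mean equicontinuity\<close>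

text \<open>The assumption \<open>0 \<le> b\<close> covers the empty set, whose diameter is 0 by
  convention.\<close>

lemma (in Metric_space) mdiameter_le:
  assumes "0 \<le> b" "\<And>x y. x \<in> S \<Longrightarrow> y \<in> S \<Longrightarrow> d x y \<le> b"
  shows "mdiameter S \<le> b"
  using assms unfolding mdiameter_def by (auto intro!: cSUP_least)

lemma diam_mean_equicontinuity_point_gap_shift:
  assumes x: "x \<in> gap_shift" "x n = 2"
  shows "gap.diam_mean_equicontinuity_point x"
  unfolding gap.diam_mean_equicontinuity_point_def
proof (intro conjI allI impI)
  fix \<epsilon> :: real assume "\<epsilon> > 0"
  then have "\<epsilon> / 2 > 0" by simp
  then obtain r where r: "\<And>x y :: nat \<Rightarrow> real. (\<And>i. i \<le> r \<Longrightarrow> x i = y i) \<Longrightarrow> dist x y < \<epsilon> / 2"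
    by (rule dist_fun_less_if_agree) blast
  \<comment> \<open>The ball only has to fix the symbol 2 at position \<open>n\<close>;
    \<open>\<epsilon>\<close> enters through \<open>r\<close> alone.\<close>
  obtain \<delta> where \<delta>: "\<delta> > 0" "gap.mball x \<delta> \<subseteq> {x \<in> gap_shift. x n = 2}"
    using open_cylinder_gap_shift[of n 2] x unfolding gap.openin_mtopology by blast
  \<comment> \<open>A time \<open>i\<close> is exceptional if \<open>i \<le> n\<close> or if one of
    the first \<open>r + 1\<close> coordinates may be nonzero at that time. The sum over
    \<open>j\<close> is a union bound, and the guard \<open>n < i\<close> keeps the subtraction from
    truncating.\<close>
  have diam: "gap.mdiameter ((shift ^^ i) ` gap.mball x \<delta>)
      \<le> \<epsilon> / 2 + 2 * of_bool (i \<le> n) + 2 * (\<Sum>j\<le>r. of_bool (n < i \<and> i + j - n \<in> gaps))"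
    (is "_ \<le> ?b") for i
  proof (rule gap.mdiameter_le)
    show "0 \<le> ?b" using \<open>\<epsilon> > 0\<close> by (simp add: sum_nonneg)
    fix u v assume "u \<in> (shift ^^ i) ` gap.mball x \<delta>" "v \<in> (shift ^^ i) ` gap.mball x \<delta>"
    then obtain u' v' where u': "u' \<in> gap_shift" "u' n = 2" "u = (\<lambda>j. u' (j + i))"
      and v': "v' \<in> gap_shift" "v' n = 2" "v = (\<lambda>j. v' (j + i))"
      using \<delta>(2) unfolding shift_funpow by blast
    show "dist u v \<le> ?b"
    proof (cases "\<exists>j\<le>r. n < i \<and> i + j - n \<in> gaps")
      case True
      then obtain j where j: "j \<le> r" "n < i \<and> i + j - n \<in> gaps" by blast
      have "(1 :: real) = of_bool (n < i \<and> i + j - n \<in> gaps)" using j by simp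
      also have "\<dots> \<le> (\<Sum>j\<le>r. of_bool (n < i \<and> i + j - n \<in> gaps))"
        by (rule member_le_sum) (use j in auto)
      finally have "(2 :: real) \<le> 2 * (\<Sum>j\<le>r. of_bool (n < i \<and> i + j - n \<in> gaps))" by simp
      moreover have "0 \<le> \<epsilon> / 2 + 2 * of_bool (i \<le> n)" using \<open>\<epsilon> > 0\<close> by simp
      ultimately show ?thesis using dist_fun_le_2[of u v] by linarith
    next
      case False
      have sum: "0 \<le> (\<Sum>j\<le>r. of_bool (n < i \<and> i + j - n \<in> gaps) :: real)"
        by (simp add: sum_nonneg)
      show ?thesis
      proof (cases "i \<le> n")
        case True
        then have "2 \<le> \<epsilon> / 2 + 2 * of_bool (i \<le> n)" using \<open>\<epsilon> > 0\<close> by simp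
        then show ?thesis using dist_fun_le_2[of u v] sum by linarith
      next
        case i: False
        \<comment> \<open>The symbol 2 at \<open>n\<close> forces zeros throughout the window, so
          \<open>u\<close> and \<open>v\<close> agree there.\<close>
        have zero: "z (j + i) = 0" if "z \<in> gap_shift" "z n = 2" "j \<le> r" for z j
        proof (rule ccontr)
          assume "z (j + i) \<noteq> 0"
          moreover have "n < j + i" using i by simp
          ultimately have "j + i - n \<in> gaps"
            using that unfolding gap_shift_def by blast
          then show False using False i that by (metis add.commute not_le)
        qed
        have "dist u v < \<epsilon> / 2"
          using zero[OF u'(1,2)] zero[OF v'(1,2)] u'(3) v'(3)
          by (intro r) simp
        moreover have "0 \<le> 2 * (of_bool (i \<le> n) :: real)" by simp
        ultimately show ?thesis using sum by linarith
      qed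
    qed
  qed
  define avg where "avg = (\<lambda>N. (\<Sum>i=1..N. gap.mdiameter ((shift ^^ i) ` gap.mball x \<delta>)) / real N)"
  \<comment> \<open>All terms except \<open>\<epsilon> / 2\<close> tend to 0, which leaves room for
    the strict inequality.\<close>
  define b where "b = (\<lambda>N. \<epsilon> / 2 + 2 * real n / real N
    + 2 * (real r + 1) * (real (card (gaps \<inter> {..N + r})) / real N))"
  have "avg N \<le> b N" if "N \<ge> 1" for N
  proof -
    have count: "(\<Sum>i=1..N. of_bool (n < i \<and> i + j - n \<in> gaps)) \<le> real (card (gaps \<inter> {..N + r}))"
      if "j \<le> r" for j
    proof -
      \<comment> \<open>For fixed \<open>j\<close> the map \<open>i + j - n\<close> is injective on
        \<open>i > n\<close>, with values at most \<open>N + r\<close>.\<close>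
      have "card {i \<in> {1..N}. n < i \<and> i + j - n \<in> gaps} \<le> card (gaps \<inter> {..N + r})"
        using that by (intro card_inj_on_le[of "\<lambda>i. i + j - n"]) (auto simp: inj_on_def)
      then show ?thesis by (simp add: of_bool_def sum.If_cases Int_def)
    qed
    have "(\<Sum>i=1..N. of_bool (i \<le> n)) = real (card {i \<in> {1..N}. i \<le> n})"
      by (simp add: of_bool_def sum.If_cases Int_def)
    also have "\<dots> \<le> real (card {1..n})"
      by (intro of_nat_mono card_mono) auto
    finally have le_n: "(\<Sum>i=1..N. of_bool (i \<le> n)) \<le> real n" by simp
    have "(\<Sum>i=1..N. \<Sum>j\<le>r. of_bool (n < i \<and> i + j - n \<in> gaps))
        = (\<Sum>j\<le>r. \<Sum>i=1..N. of_bool (n < i \<and> i + j - n \<in> gaps) :: real)"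
      by (rule sum.swap)
    also have "\<dots> \<le> (\<Sum>j\<le>r. real (card (gaps \<inter> {..N + r})))"
      by (intro sum_mono count) simp
    finally have dbl: "(\<Sum>i=1..N. \<Sum>j\<le>r. of_bool (n < i \<and> i + j - n \<in> gaps))
        \<le> (real r + 1) * real (card (gaps \<inter> {..N + r}))" by (simp add: add.commute)
    have "(\<Sum>i=1..N. gap.mdiameter ((shift ^^ i) ` gap.mball x \<delta>))
        \<le> (\<Sum>i=1..N. \<epsilon> / 2 + 2 * of_bool (i \<le> n) + 2 * (\<Sum>j\<le>r. of_bool (n < i \<and> i + j - n \<in> gaps)))"
      by (intro sum_mono diam)
    also have "\<dots> = real N * \<epsilon> / 2 + 2 * (\<Sum>i=1..N. of_bool (i \<le> n))
        + 2 * (\<Sum>i=1..N. \<Sum>j\<le>r. of_bool (n < i \<and> i + j - n \<in> gaps))"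
      by (simp add: sum.distrib flip: sum_distrib_left)
    also have "\<dots> \<le> real N * \<epsilon> / 2 + 2 * real n + 2 * ((real r + 1) * real (card (gaps \<inter> {..N + r})))"
      using le_n dbl by linarith
    finally have "avg N \<le> (real N * \<epsilon> / 2 + 2 * real n
        + 2 * ((real r + 1) * real (card (gaps \<inter> {..N + r})))) / real N"
      unfolding avg_def by (simp add: divide_right_mono)
    also have "\<dots> = b N"
      using that unfolding b_def by (simp add: add_divide_distrib)
    finally show ?thesis .
  qed
  then have "limsup (\<lambda>N. ereal (avg N)) \<le> limsup (\<lambda>N. ereal (b N))"
    by (intro Limsup_mono) (auto intro!: eventually_sequentiallyI[of 1])
  also have "\<dots> = ereal (\<epsilon> / 2)"
  proof -
    have "b \<longlonglongrightarrow> \<epsilon> / 2 + 0 + 2 * (real r + 1) * 0"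
      unfolding b_def by (intro tendsto_intros gaps_density_zero)
    then show ?thesis by (intro lim_imp_Limsup) auto
  qed
  also have "\<dots> < ereal \<epsilon>" using \<open>\<epsilon> > 0\<close> by simp
  finally show "\<exists>\<delta>>0. limsup (\<lambda>N. ereal ((\<Sum>i=1..N. gap.mdiameter ((shift ^^ i) ` gap.mball x \<delta>)) / real N)) < ereal \<epsilon>"
    using \<delta>(1) unfolding avg_def by blast
qed (use x in auto)

section \<open>Residuality of the equicontinuity points\<close>

text \<open>A single dense open set \<open>G\<close> suffices. By transitivity every nonempty open
  set has a point whose orbit enters the cylinder of 2, that is, a point of
  \<open>G\<close>.\<close>

lemma almost_diam_mean_equicontinuous_gap_shift: "gap.almost_diam_mean_equicontinuous"
proof -
  define G where "G = (\<Union>n. {x \<in> gap_shift. x n = 2})"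
  have "openin gap.mtopology G"
    unfolding G_def using open_cylinder_gap_shift by blast
  moreover have "gap.mtopology closure_of G = topspace gap.mtopology"
  proof -
    have "G \<inter> U \<noteq> {}" if U: "openin gap.mtopology U" "U \<noteq> {}" for U
    proof -
      \<comment> \<open>Transitivity needs a nonempty target, and a 2 followed by zeros is always
        admissible.\<close>
      have "(\<lambda>i. if i = 0 then 2 else 0) \<in> {x \<in> gap_shift. x 0 = 2}"
        by (auto simp: gap_shift_def)
      then obtain n z where "z \<in> U" "(shift ^^ n) z \<in> {x \<in> gap_shift. x 0 = 2}"
        using transitive_gap_shift U open_cylinder_gap_shift[of 0 2]
        unfolding gap.transitive_def by blast
      then have "z \<in> G \<inter> U"
        using openin_subset[OF U(1)] by (auto simp: G_def shift_funpow)
      then show ?thesis by blast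
    qed
    then show ?thesis unfolding dense_intersects_open by blast
  qed
  moreover have "G \<subseteq> {x. gap.diam_mean_equicontinuity_point x}"
    unfolding G_def using diam_mean_equicontinuity_point_gap_shift by blast
  moreover have "{x. gap.diam_mean_equicontinuity_point x} \<subseteq> topspace gap.mtopology"
    by (auto simp: gap.diam_mean_equicontinuity_point_def)
  ultimately show ?thesis
    unfolding gap.almost_diam_mean_equicontinuous_def residual_in_def
    by (intro conjI exI[of _ "{G}"]) (simp_all add: le_infI2)
qed

section \<open>Entropy\<close>

text \<open>A finite cover is a subcover of itself, so the infimum ranges over a nonempty
  set.\<close>

lemma min_subcover_card_ge:
  assumes "finite \<U>" "\<Union>\<U> = topspace X"
    and "\<And>\<V>. \<V> \<subseteq> \<U> \<Longrightarrow> finite \<V> \<Longrightarrow> \<Union>\<V> = topspace X \<Longrightarrow> k \<le> card \<V>"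
  shows "k \<le> min_subcover_card X \<U>"
  unfolding min_subcover_card_def
  using assms by (intro cInf_greatest) auto

text \<open>The refinement consists of cylinders over \<open>n\<close> coordinates. The
  \<open>2 ^ n\<close> words over 0 and 1 all occur, and no cylinder contains two of them.\<close>

lemma min_subcover_card_gap_shift:
  defines "\<U> \<equiv> (\<lambda>s. {x \<in> gap_shift. x 0 = s}) ` {0, 1, 2}"
  shows "2 ^ n \<le> min_subcover_card gap.mtopology (cover_refinement gap.mtopology shift \<U> n)"
proof (rule min_subcover_card_ge)
  have ref: "cover_refinement gap.mtopology shift \<U> n
      = {{x \<in> gap_shift. \<forall>i<n. x i = s i} |s. \<forall>i<n. s i \<in> {0, 1, 2}}" (is "?L = ?R")
  proof (intro subset_antisym subsetI)
    fix A assume "A \<in> ?L"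
    then obtain W where W: "\<forall>i<n. W i \<in> \<U>" "A = {x \<in> gap_shift. \<forall>i<n. (shift ^^ i) x \<in> W i}"
      unfolding cover_refinement_def by auto
    from W(1) have "\<forall>i. \<exists>s. i < n \<longrightarrow> s \<in> {0, 1, 2} \<and> W i = {x \<in> gap_shift. x 0 = s}"
      unfolding \<U>_def by blast
    from choice[OF this] obtain s
      where s: "\<And>i. i < n \<Longrightarrow> s i \<in> {0, 1, 2} \<and> W i = {x \<in> gap_shift. x 0 = s i}"
      by blast
    then have "A = {x \<in> gap_shift. \<forall>i<n. x i = s i}"
      using W(2) funpow_shift_mem_gap_shift by (auto simp: shift_funpow)
    then show "A \<in> ?R" using s by blast
  next
    fix A assume "A \<in> ?R"
    then obtain s where s: "\<forall>i<n. s i \<in> {0, 1, 2}" "A = {x \<in> gap_shift. \<forall>i<n. x i = s i}"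
      by blast
    have "A = {x \<in> topspace gap.mtopology. \<forall>i<n. (shift ^^ i) x \<in> {x \<in> gap_shift. x 0 = s i}}"
      using s(2) funpow_shift_mem_gap_shift by (auto simp: shift_funpow)
    moreover have "\<forall>i<n. {x \<in> gap_shift. x 0 = s i} \<in> \<U>"
      using s(1) unfolding \<U>_def by blast
    ultimately show "A \<in> ?L"
      unfolding cover_refinement_def
      by (intro CollectI exI[of _ "\<lambda>i. {x \<in> gap_shift. x 0 = s i}"] conjI)
  qed
  have "?R \<subseteq> (\<lambda>s. {x \<in> gap_shift. \<forall>i<n. x i = s i}) ` PiE {..<n} (\<lambda>_. {0, 1, 2})"
  proof
    fix A assume "A \<in> ?R"
    then obtain s where s: "\<forall>i<n. s i \<in> {0, 1, 2}" "A = {x \<in> gap_shift. \<forall>i<n. x i = s i}"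
      by blast
    \<comment> \<open>Restricting \<open>s\<close> to \<open>{..<n}\<close> leaves finitely many
      words.\<close>
    then have "A = {x \<in> gap_shift. \<forall>i<n. x i = restrict s {..<n} i}" by auto
    moreover have "restrict s {..<n} \<in> PiE {..<n} (\<lambda>_. {0, 1, 2})" using s(1) by auto
    ultimately show "A \<in> (\<lambda>s. {x \<in> gap_shift. \<forall>i<n. x i = s i}) ` PiE {..<n} (\<lambda>_. {0, 1, 2})"
      by blast
  qed
  then show "finite ?L"
    unfolding ref by (rule finite_subset) (intro finite_imageI finite_PiE, auto)
  show "\<Union>?L = topspace gap.mtopology"
  proof -
    have "x \<in> \<Union>?R" if "x \<in> gap_shift" for x
    proof
      show "x \<in> {y \<in> gap_shift. \<forall>i<n. y i = x i}" using that by simp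
      show "{y \<in> gap_shift. \<forall>i<n. y i = x i} \<in> ?R"
        using that by (auto simp: gap_shift_def image_subset_iff)
    qed
    then show ?thesis unfolding ref by auto
  qed
  fix \<V> assume \<V>: "\<V> \<subseteq> ?L" "finite \<V>" "\<Union>\<V> = topspace gap.mtopology"
  \<comment> \<open>Indicator functions encode the sequences over 0 and 1; without a 2 they are
    subject to no constraint.\<close>
  have "(indicator A :: nat \<Rightarrow> real) \<in> \<Union>\<V>" for A
    unfolding \<V>(3) gap.topspace_mtopology by (auto simp: gap_shift_def indicator_def)
  then have "\<forall>A. \<exists>V. V \<in> \<V> \<and> (indicator A :: nat \<Rightarrow> real) \<in> V" by blast
  from choice[OF this] obtain f where f: "\<And>A. f A \<in> \<V> \<and> indicator A \<in> f A"
    by blast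
  have "inj_on f (Pow {..<n})"
  proof (rule inj_onI)
    fix A B assume AB: "A \<in> Pow {..<n}" "B \<in> Pow {..<n}" "f A = f B"
    then obtain s where s: "f A = {x \<in> gap_shift. \<forall>i<n. x i = s i}"
    proof -
      have "f A \<in> ?R" using f[of A] \<V>(1) unfolding ref by (meson subsetD)
      then show ?thesis using that by (elim CollectE exE conjE)
    qed
    have "indicator A \<in> f A" "indicator B \<in> f A"
      using f[of A] f[of B] AB(3) by simp_all
    then have eq: "indicator A i = (indicator B i :: real)" if "i < n" for i
      using that unfolding s by simp
    have "i \<in> A \<longleftrightarrow> i \<in> B" if "i < n" for i
      using eq[OF that] by (simp add: indicator_def of_bool_def split: if_splits)
    then show "A = B" using AB by auto
  qed
  then have "card (Pow {..<n}) \<le> card \<V>"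
    using f \<V>(2) by (intro card_inj_on_le) auto
  then show "2 ^ n \<le> card \<V>" by (simp add: card_Pow)
qed

lemma topological_entropy_gap_shift: "ereal (ln 2) \<le> topological_entropy gap.mtopology shift"
proof -
  define \<U> where "\<U> = (\<lambda>s. {x \<in> gap_shift. x 0 = s}) ` {0, 1, 2 :: real}"
  have "open_cover gap.mtopology \<U>"
    unfolding open_cover_def \<U>_def
  proof
    show "\<Union> ((\<lambda>s. {x \<in> gap_shift. x 0 = s}) ` {0, 1, 2}) = topspace gap.mtopology"
      unfolding gap.topspace_mtopology by (auto simp: gap_shift_def image_subset_iff)
  qed (use open_cylinder_gap_shift in auto)
  \<comment> \<open>At \<open>n = 0\<close> the quotient is 0 and the bound fails, but the upper
    limit ignores this term.\<close>
  have "ln 2 \<le> ln (real (min_subcover_card gap.mtopology (cover_refinement gap.mtopology shift \<U> n))) / real n"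
    if "n \<ge> 1" for n
  proof -
    have "(2 :: real) ^ n \<le> real (min_subcover_card gap.mtopology (cover_refinement gap.mtopology shift \<U> n))"
      using of_nat_mono[OF min_subcover_card_gap_shift[of n], where 'a = real]
      unfolding \<U>_def of_nat_power of_nat_numeral .
    then have "ln (2 ^ n) \<le> ln (real (min_subcover_card gap.mtopology (cover_refinement gap.mtopology shift \<U> n)))"
      by (intro ln_mono) (auto intro: less_le_trans[of _ "2 ^ n"])
    then show ?thesis
      using that by (simp add: ln_realpow field_simps)
  qed
  then have "limsup (\<lambda>n. ereal (ln 2)) \<le> cover_entropy gap.mtopology shift \<U>"
    unfolding cover_entropy_def
    by (intro Limsup_mono) (auto intro!: eventually_sequentiallyI[of 1])
  also have "\<dots> \<le> topological_entropy gap.mtopology shift"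
    unfolding topological_entropy_def using \<open>open_cover gap.mtopology \<U>\<close> by (intro SUP_upper) simp
  finally show ?thesis by (simp add: Limsup_const)
qed

theorem corollary5p7:
  shows "\<exists>(M :: (nat \<Rightarrow> real) set) (d :: (nat \<Rightarrow> real) \<Rightarrow> (nat \<Rightarrow> real) \<Rightarrow> real)
           (T :: (nat \<Rightarrow> real) \<Rightarrow> (nat \<Rightarrow> real)).
           topological_dynamical_system M d T \<and>
           topological_dynamical_system.transitive M d T \<and>
           topological_dynamical_system.almost_diam_mean_equicontinuous M d T \<and>
           topological_entropy (Metric_space.mtopology M d) T > 0"
proof (intro exI conjI)
  show "topological_dynamical_system gap_shift dist shift"
    by (rule gap.topological_dynamical_system_axioms)
  show "topological_dynamical_system.transitive gap_shift dist shift"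
    by (rule transitive_gap_shift)
  show "topological_dynamical_system.almost_diam_mean_equicontinuous gap_shift dist shift"
    by (rule almost_diam_mean_equicontinuous_gap_shift)
  have "0 < ereal (ln 2)" by simp
  then show "0 < topological_entropy (Metric_space.mtopology gap_shift dist) shift"
    using topological_entropy_gap_shift by (rule less_le_trans)
qed

end
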